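(* For every $d\ge 2$, any one-pass streaming algorithm for $d$-SAT in the clause arrival model requires storage of $\Omega((N/d)^d)$ bits, where $N$ is the number of variables.
   Context: $d$-SAT: given a CNF formula over $N$ Boolean variables in which every clause has at most $d$ literals, decide whether it is satisfiable. Clause arrival model: the set of $N$ variables is fixed and the clauses arrive one by one in a stream, read in a single pass; the algorithm may perform unbounded computation and its space is the number of bits it stores. The lower bound applies also to randomized algorithms answering correctly with constant probability (say at least $2/3$). *)

theory Defs
  imports "HOL-Probability.Probability"
begin

datatype lit = Pos nat | Neg nat

fun lit_var :: "lit \<Rightarrow> nat" where
  "lit_var (Pos v) = v"
| "lit_var (Neg v) = v"

fun lit_true :: "(nat \<Rightarrow> bool) \<Rightarrow> lit \<Rightarrow> bool" where
  "lit_true \<sigma> (Pos v) = \<sigma> v"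
| "lit_true \<sigma> (Neg v) = (\<not> \<sigma> v)"

type_synonym clause = "lit set"

definition satisfiable :: "clause list \<Rightarrow> bool" where
  "satisfiable cs \<longleftrightarrow> (\<exists>\<sigma>. \<forall>C \<in> set cs. \<exists>l \<in> C. lit_true \<sigma> l)"

text \<open>The variables are the numbers below \<open>N\<close>; an instance of \<open>d\<close>-SAT is the list of its
  clauses in order of arrival.\<close>

definition dsat_instance :: "nat \<Rightarrow> nat \<Rightarrow> clause list \<Rightarrow> bool" where
  "dsat_instance d N cs \<longleftrightarrow> (\<forall>C \<in> set cs. lit_var ` C \<subseteq> {..<N} \<and> card C \<le> d)"

text \<open>The memory content between two clauses is a bit string. An algorithm may use two kinds of
  randomness: a random string drawn once, which stays available throughout and is not charged as
  storage, and fresh coins in each operation, which are lost unless stored. The maps are arbitrary,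
  so computation is unbounded. Deterministic algorithms are those in which every distribution is
  a point mass.\<close>

type_synonym memory = "bool list"

record streaming_alg =
  shared :: "bool list pmf"
  start :: "bool list \<Rightarrow> memory pmf"
  process :: "bool list \<Rightarrow> memory \<Rightarrow> clause \<Rightarrow> memory pmf"
  answer :: "bool list \<Rightarrow> memory \<Rightarrow> bool pmf"

definition run :: "streaming_alg \<Rightarrow> bool list \<Rightarrow> clause list \<Rightarrow> memory pmf" where
  "run A r cs = foldl (\<lambda>p C. bind_pmf p (\<lambda>m. process A r m C)) (start A r) cs"

definition outcome :: "streaming_alg \<Rightarrow> clause list \<Rightarrow> bool pmf" where
  "outcome A cs = bind_pmf (shared A) (\<lambda>r. bind_pmf (run A r cs) (answer A r))"

definition solves_dsat :: "nat \<Rightarrow> nat \<Rightarrow> streaming_alg \<Rightarrow> bool" where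
  "solves_dsat d N A \<longleftrightarrow>
     (\<forall>cs. dsat_instance d N cs \<longrightarrow> pmf (outcome A cs) (satisfiable cs) \<ge> 2 / 3)"

text \<open>Every prefix of an instance is again an instance, so this bounds the memory content at all
  times of the pass and not only at its end.\<close>

definition stores_at_most :: "nat \<Rightarrow> nat \<Rightarrow> streaming_alg \<Rightarrow> nat \<Rightarrow> bool" where
  "stores_at_most d N A s \<longleftrightarrow>
     (\<forall>cs. dsat_instance d N cs \<longrightarrow>
       (\<forall>r \<in> set_pmf (shared A). \<forall>m \<in> set_pmf (run A r cs). length m \<le> s))"

end

theory Submission imports Defs begin

text \<open>The \<open>N choose d\<close> positive clauses of size exactly \<open>d\<close> carry an instance of the INDEX problem:
  the prefix of the stream is a set \<open>X\<close> of such clauses, and appending the unit clauses that falsify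
  all variables of one clause \<open>S\<close> makes the formula unsatisfiable iff \<open>S \<in> X\<close>. The memory after the
  prefix is therefore a randomized random access code for \<open>N choose d \<ge> (N/d)^d\<close> bits.

  To bound such codes, let \<open>g m X\<close> be the expected number of the \<open>n\<close> bits of \<open>X\<close> decoded correctly
  from \<open>m\<close>. Since \<open>2 powr p + 2 powr (1 - p) \<le> 3\<close> on the unit interval, \<open>2 powr g m X\<close> sums over
  all \<open>X\<close> to at most \<open>3 ^ n\<close>; on the other hand the average of \<open>g\<close> over \<open>X\<close> is at least \<open>2n/3\<close>, so
  Jensen's inequality gives \<open>2 ^ n * 2 powr (2n/3) \<le> |M| * 3 ^ n\<close> for the set \<open>M\<close> of messages.\<close>

section \<open>Size of randomized random access codes\<close>

lemma two_powr_le: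
  fixes p :: real
  assumes "0 \<le> p" "p \<le> 1"
  shows "2 powr p \<le> 1 + p"
  \<comment> \<open>Weighted AM-GM of 2 and 1: on the unit interval the convex power lies below its
    chord.\<close>
  using Youngs_inequality_0[of p "1 - p" 2 1] assms by (simp add: algebra_simps)

text \<open>The exponential turns the sum over \<open>I\<close> into a product, and the sum over all
  subsets factors by distributivity (\<open>prod_add\<close>). Each factor is at most (1 + p) + (1 +
  (1 - p)) = 3.\<close>

lemma sum_Pow_powr_le:
  fixes q :: "'i \<Rightarrow> bool pmf"
  assumes "finite I"
  shows "(\<Sum>X\<in>Pow I. 2 powr (\<Sum>i\<in>I. pmf (q i) (i \<in> X))) \<le> 3 ^ card I"
proof -
  have "(\<Sum>X\<in>Pow I. 2 powr (\<Sum>i\<in>I. pmf (q i) (i \<in> X)))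
      = (\<Sum>X\<in>Pow I. (\<Prod>i\<in>X. 2 powr pmf (q i) True) * (\<Prod>i\<in>I-X. 2 powr pmf (q i) False))"
  proof (rule sum.cong[OF refl])
    fix X assume X: "X \<in> Pow I"
    have "2 powr (\<Sum>i\<in>I. pmf (q i) (i \<in> X)) = (\<Prod>i\<in>I. 2 powr pmf (q i) (i \<in> X))"
      using assms by (subst powr_sum) auto
    also have "\<dots> = (\<Prod>i\<in>I-X. 2 powr pmf (q i) (i \<in> X)) * (\<Prod>i\<in>X. 2 powr pmf (q i) (i \<in> X))"
      using X assms by (intro prod.subset_diff) auto
    also have "\<dots> = (\<Prod>i\<in>X. 2 powr pmf (q i) True) * (\<Prod>i\<in>I-X. 2 powr pmf (q i) False)"
      by (simp add: mult.commute)
    finally show "2 powr (\<Sum>i\<in>I. pmf (q i) (i \<in> X)) = \<dots>" .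
  qed
  also have "\<dots> = (\<Prod>i\<in>I. 2 powr pmf (q i) True + 2 powr pmf (q i) False)"
    using assms by (rule prod_add[symmetric])
  also have "\<dots> \<le> (\<Prod>i\<in>I. 3)"
  proof (rule prod_mono, intro conjI)
    fix i
    have "pmf (q i) False = 1 - pmf (q i) True"
      by (rule pmf_False_conv_True)
    then show "2 powr pmf (q i) True + 2 powr pmf (q i) False \<le> 3"
      using two_powr_le[of "pmf (q i) True"] two_powr_le[of "pmf (q i) False"]
      by (simp add: pmf_le_1)
  qed simp
  finally show ?thesis by simp
qed

lemma integrable_pmf_value:
  "integrable (measure_pmf p) (\<lambda>x. pmf (f x) (b x))"
  by (rule measure_pmf.integrable_const_bound[where B = 1]) (auto simp: pmf_le_1)

text \<open>This is \<open>2 ^ n * 2 powr (2 * n / 3) \<le> card M * 3 ^ n\<close> cubed, which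
  clears the fractional exponent. Since 32 > 27, it forces \<open>card M\<close> to grow
  exponentially in \<open>n\<close>. The success probability is bounded for each fixed shared
  \<open>r\<close> and then averaged over \<open>r\<close>.\<close>

lemma random_access_code_bound:
  fixes R :: "'r pmf" and enc :: "'r \<Rightarrow> 'i set \<Rightarrow> 'm pmf" and dec :: "'r \<Rightarrow> 'm \<Rightarrow> 'i \<Rightarrow> bool pmf"
  assumes I: "finite I" and M: "finite M"
    and enc: "\<And>r X. r \<in> set_pmf R \<Longrightarrow> X \<subseteq> I \<Longrightarrow> set_pmf (enc r X) \<subseteq> M"
    and correct: "\<And>X i. X \<subseteq> I \<Longrightarrow> i \<in> I \<Longrightarrow>
      pmf (bind_pmf R (\<lambda>r. bind_pmf (enc r X) (\<lambda>m. dec r m i))) (i \<in> X) \<ge> 2 / 3"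
  shows "32 ^ card I \<le> 27 ^ card I * card M ^ 3"
proof -
  define n where "n = card I"
  define y where "y = 2 * real n / 3"
  define g where "g r m X = (\<Sum>i\<in>I. pmf (dec r m i) (i \<in> X))" for r m X
  define h where "h r X i = pmf (bind_pmf (enc r X) (\<lambda>m. dec r m i)) (i \<in> X)" for r X i
  \<comment> \<open>\<open>W r X\<close> dominates \<open>2 powr g r m X\<close> whichever message
    \<open>m\<close> is sent for \<open>X\<close>; summing over all messages is what costs the
    factor \<open>card M\<close>.\<close>
  define W where "W r X = (\<Sum>m\<in>M. 2 powr g r m X)" for r X
  have card_Pow_I: "real (card (Pow I)) = 2 ^ n"
    using I by (simp add: card_Pow n_def)
  \<comment> \<open>The tangent of \<open>z \<mapsto> 2 powr z\<close> at \<open>y\<close> takes the place of Jensen's inequality.\<close>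
  have tangent: "z \<le> y + (2 powr z * 2 powr (-y) - 1) / ln 2" for z :: real
  proof -
    have "1 + (z - y) * ln 2 \<le> exp ((z - y) * ln 2)"
      by (rule exp_ge_add_one_self)
    also have "\<dots> = 2 powr z * 2 powr (-y)"
      by (simp add: powr_def exp_add[symmetric] algebra_simps)
    finally have "(z - y) \<le> (2 powr z * 2 powr (-y) - 1) / ln 2"
      by (simp add: pos_le_divide_eq)
    then show ?thesis by simp
  qed
  have pointwise: "(\<Sum>i\<in>I. h r X i) \<le> y + (W r X * 2 powr (-y) - 1) / ln 2"
    if r: "r \<in> set_pmf R" and X: "X \<subseteq> I" for r X
  proof -
    have "(\<Sum>i\<in>I. h r X i) = (\<Sum>i\<in>I. \<integral>m. pmf (dec r m i) (i \<in> X) \<partial>enc r X)"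
      by (simp add: h_def pmf_bind)
    also have "\<dots> = (\<integral>m. g r m X \<partial>enc r X)"
      unfolding g_def by (subst Bochner_Integration.integral_sum) (auto intro: integrable_pmf_value)
    also have "\<dots> \<le> y + (W r X * 2 powr (-y) - 1) / ln 2"
    proof (rule measure_pmf.integral_le_const)
      show "integrable (measure_pmf (enc r X)) (\<lambda>m. g r m X)"
        unfolding g_def by (intro Bochner_Integration.integrable_sum integrable_pmf_value)
      show "AE m in enc r X. g r m X \<le> y + (W r X * 2 powr (-y) - 1) / ln 2"
      proof (rule AE_pmfI)
        fix m assume "m \<in> set_pmf (enc r X)"
        then have "m \<in> M" using enc[OF r X] by blast
        then have "2 powr g r m X \<le> W r X"
          unfolding W_def using M by (intro member_le_sum) auto
        then have "(2 powr g r m X * 2 powr (-y) - 1) / ln 2 \<le> (W r X * 2 powr (-y) - 1) / ln 2"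
          by (intro divide_right_mono diff_right_mono mult_right_mono) auto
        then show "g r m X \<le> y + (W r X * 2 powr (-y) - 1) / ln 2"
          using tangent[of "g r m X"] by linarith
      qed
    qed
    finally show ?thesis .
  qed
  have sum_W: "(\<Sum>X\<in>Pow I. W r X) \<le> real (card M) * 3 ^ n" for r
  proof -
    have "(\<Sum>X\<in>Pow I. W r X) = (\<Sum>m\<in>M. \<Sum>X\<in>Pow I. 2 powr g r m X)"
      unfolding W_def by (rule sum.swap)
    also have "\<dots> \<le> (\<Sum>m\<in>M. 3 ^ n)"
      unfolding g_def n_def by (intro sum_mono sum_Pow_powr_le I)
    finally show ?thesis by simp
  qed
  define U where "U = 2 ^ n * y + (real (card M) * 3 ^ n * 2 powr (-y) - 2 ^ n) / ln 2"
  have upper: "(\<Sum>X\<in>Pow I. \<Sum>i\<in>I. h r X i) \<le> U" if r: "r \<in> set_pmf R" for r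
  proof -
    have "(\<Sum>X\<in>Pow I. \<Sum>i\<in>I. h r X i) \<le> (\<Sum>X\<in>Pow I. y + (W r X * 2 powr (-y) - 1) / ln 2)"
      by (intro sum_mono pointwise r) auto
    also have "\<dots> = 2 ^ n * y + ((\<Sum>X\<in>Pow I. W r X) * 2 powr (-y) - 2 ^ n) / ln 2"
      by (simp add: sum.distrib sum_subtractf card_Pow_I flip: sum_divide_distrib sum_distrib_right)
    also have "\<dots> \<le> U"
      unfolding U_def using sum_W[of r]
      by (intro add_left_mono divide_right_mono diff_right_mono mult_right_mono) auto
    finally show ?thesis .
  qed
  have "2 ^ n * y = (\<Sum>X\<in>Pow I. \<Sum>i\<in>I. 2 / 3)"
    using card_Pow_I by (simp add: y_def n_def)
  also have "\<dots> \<le> (\<Sum>X\<in>Pow I. \<Sum>i\<in>I. \<integral>r. h r X i \<partial>R)"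
    using correct by (intro sum_mono) (auto simp: pmf_bind h_def)
  also have "\<dots> = (\<integral>r. (\<Sum>X\<in>Pow I. \<Sum>i\<in>I. h r X i) \<partial>R)"
    unfolding h_def
    by (subst Bochner_Integration.integral_sum Bochner_Integration.integral_sum,
        auto intro!: integrable_pmf_value Bochner_Integration.integrable_sum sum.cong
          Bochner_Integration.integral_sum[symmetric])
  also have "\<dots> \<le> U"
    using upper unfolding h_def
    by (intro measure_pmf.integral_le_const)
      (auto intro!: integrable_pmf_value Bochner_Integration.integrable_sum AE_pmfI)
  \<comment> \<open>The tangent was taken at the guaranteed average \<open>y\<close>, so the terms
    \<open>2 ^ n * y\<close> cancel and the remaining quotient by \<open>ln 2\<close> is
    nonnegative.\<close>
  finally have "2 ^ n \<le> real (card M) * 3 ^ n * 2 powr (-y)"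
    by (simp add: U_def zero_le_divide_iff)
  then have "2 ^ n * 2 powr y \<le> real (card M) * 3 ^ n"
    by (simp add: powr_minus divide_simps mult.commute)
  then have "(2 ^ n * 2 powr y) ^ 3 \<le> (real (card M) * 3 ^ n) ^ 3"
    by (intro power_mono) auto
  moreover have "(2 powr y) ^ 3 = (4::real) ^ n"
  proof -
    have "(2 powr y) ^ 3 = 2 powr (real (2 * n))"
      by (simp add: y_def powr_power)
    also have "\<dots> = 4 ^ n"
      by (subst powr_realpow) (auto simp: power_mult)
    finally show ?thesis .
  qed
  moreover have "((2::real) ^ n) ^ 3 * 4 ^ n = 32 ^ n" "((3::real) ^ n) ^ 3 = 27 ^ n"
    by (simp_all add: power_commutes power3_eq_cube flip: power_mult_distrib)
  ultimately have "(32::real) ^ n \<le> 27 ^ n * real (card M) ^ 3"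
    by (simp add: power_mult_distrib mult.commute)
  then have "real (32 ^ n) \<le> real (27 ^ n * card M ^ 3)"
    by simp
  then show ?thesis
    unfolding n_def of_nat_le_iff .
qed

section \<open>Streaming algorithms as random access codes\<close>

definition resume :: "streaming_alg \<Rightarrow> bool list \<Rightarrow> memory \<Rightarrow> clause list \<Rightarrow> memory pmf" where
  "resume A r m cs = foldl (\<lambda>p C. bind_pmf p (\<lambda>m. process A r m C)) (return_pmf m) cs"

lemma run_append: "run A r (cs @ ds) = bind_pmf (run A r cs) (\<lambda>m. resume A r m ds)"
  by (induction ds rule: rev_induct)
    (simp_all add: run_def resume_def bind_return_pmf' bind_assoc_pmf flip: append_assoc)

text \<open>Cuts the run at the message \<open>m\<close>: the prefix \<open>cs\<close> is encoded,
  the suffix \<open>ds\<close> is the query, and besides \<open>m\<close> the two sides have only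
  \<open>r\<close> in common.\<close>

lemma outcome_append:
  "outcome A (cs @ ds) =
    bind_pmf (shared A) (\<lambda>r. bind_pmf (run A r cs) (\<lambda>m. bind_pmf (resume A r m ds) (answer A r)))"
  by (simp add: outcome_def run_append bind_assoc_pmf)

text \<open>The units make \<open>S\<close> false, so a positive clause on \<open>T\<close> fails
  only if \<open>T \<subseteq> S\<close>, which for equal cardinalities means \<open>T = S\<close>.
  Otherwise making exactly the variables outside \<open>S\<close> true satisfies everything.\<close>

lemma satisfiable_positive_clauses_with_negative_units:
  assumes card: "\<And>T. T \<in> X \<Longrightarrow> card T = card S" and "finite S"
    and cs: "set cs = (`) Pos ` X" and ds: "set ds = (\<lambda>v. {Neg v}) ` S"
  shows "satisfiable (cs @ ds) \<longleftrightarrow> S \<notin> X"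
proof
  assume "satisfiable (cs @ ds)"
  then obtain \<sigma> where \<sigma>: "\<forall>C \<in> set cs \<union> set ds. \<exists>l \<in> C. lit_true \<sigma> l"
    unfolding satisfiable_def by auto
  have "\<not> \<sigma> v" if "v \<in> S" for v
    using \<sigma> that unfolding ds ball_Un ball_simps by auto
  moreover have "\<exists>v\<in>T. \<sigma> v" if "T \<in> X" for T
    using \<sigma> that unfolding cs ball_Un ball_simps by auto
  ultimately show "S \<notin> X"
    by blast
next
  assume "S \<notin> X"
  then have "\<exists>v\<in>T. v \<notin> S" if "T \<in> X" for T
    using card_subset_eq[OF \<open>finite S\<close>, of T] card[OF that] that by blast
  then show "satisfiable (cs @ ds)"
    unfolding satisfiable_def set_append cs ds
    by (intro exI[of _ "\<lambda>v. v \<notin> S"]) (auto simp: image_iff)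
qed

lemma finite_memory: "finite {m :: memory. length m \<le> s}"
  using finite_lists_length_le[of "UNIV :: bool set" s] by simp

lemma card_memory_le: "card {m :: memory. length m \<le> s} \<le> 2 ^ (s + 1)"
proof -
  have "card {m :: memory. length m \<le> s} = (\<Sum>i\<le>s. 2 ^ i)"
    using card_lists_length_le[of "UNIV :: bool set" s] by simp
  also have "\<dots> = 2 ^ (s + 1) - 1"
    by (induction s) auto
  finally show ?thesis by simp
qed

lemma dsat_memory_bound:
  assumes solves: "solves_dsat d N A" and stores: "stores_at_most d N A s" and "d \<ge> 1"
  shows "32 ^ (N choose d) \<le> (27::nat) ^ (N choose d) * 8 ^ (s + 1)"
proof -
  define I where "I = {S. S \<subseteq> {..<N} \<and> card S = d}"
  define M where "M = {m :: memory. length m \<le> s}"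
  have I: "finite I" "card I = N choose d"
    unfolding I_def using n_subsets[of "{..<N}" d] by auto
  have fin: "finite S" if "S \<in> I" for S
    using that finite_subset by (auto simp: I_def)
  \<comment> \<open>Any order of arrival will do.\<close>
  define cs where "cs X = (SOME cs. set cs = (`) Pos ` X)" for X
  define ds where "ds S = (SOME cs. set cs = (\<lambda>v. {Neg v}) ` S)" for S
  have cs: "set (cs X) = (`) Pos ` X" if "X \<subseteq> I" for X
    unfolding cs_def by (rule someI_ex, rule finite_list) (use that I finite_subset in auto)
  have ds: "set (ds S) = (\<lambda>v. {Neg v}) ` S" if "S \<in> I" for S
    unfolding ds_def by (rule someI_ex, rule finite_list) (use that fin in auto)
  have inst_cs: "dsat_instance d N (cs X)" if "X \<subseteq> I" for X
    using that unfolding dsat_instance_def cs[OF that]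
    by (fastforce simp: I_def card_image inj_on_def)
  have inst: "dsat_instance d N (cs X @ ds S)" if "X \<subseteq> I" "S \<in> I" for X S
    using inst_cs[OF that(1)] ds[OF that(2)] that(2) \<open>d \<ge> 1\<close> unfolding dsat_instance_def
    by (auto simp: I_def)
  \<comment> \<open>The prefix lists the complement \<open>I - X\<close>, so that the answer
    "satisfiable" is itself the bit \<open>S \<in> X\<close>.\<close>
  have "32 ^ card I \<le> 27 ^ card I * card M ^ 3"
  proof (rule random_access_code_bound[where R = "shared A" and enc = "\<lambda>r X. run A r (cs (I - X))"
        and dec = "\<lambda>r m S. bind_pmf (resume A r m (ds S)) (answer A r)"])
    show "set_pmf (run A r (cs (I - X))) \<subseteq> M" if "r \<in> set_pmf (shared A)" for r X
      using stores that inst_cs[of "I - X"] unfolding stores_at_most_def M_def by blast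
    fix X S assume "X \<subseteq> I" and S: "S \<in> I"
    have "satisfiable (cs (I - X) @ ds S) \<longleftrightarrow> S \<notin> I - X"
      using S fin[OF S] cs[of "I - X"] ds[OF S]
      by (intro satisfiable_positive_clauses_with_negative_units) (auto simp: I_def)
    then have "satisfiable (cs (I - X) @ ds S) \<longleftrightarrow> S \<in> X"
      using S by blast
    then show "2 / 3 \<le> pmf (bind_pmf (shared A) (\<lambda>r. bind_pmf (run A r (cs (I - X)))
        (\<lambda>m. bind_pmf (resume A r m (ds S)) (answer A r)))) (S \<in> X)"
      using solves inst[of "I - X" S] S unfolding solves_dsat_def by (auto simp flip: outcome_append)
  qed (use I finite_memory in \<open>auto simp: M_def\<close>)
  also have "\<dots> \<le> 27 ^ card I * (2 ^ (s + 1)) ^ 3"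
    unfolding M_def by (intro mult_le_mono power_mono card_memory_le) auto
  also have "((2::nat) ^ (s + 1)) ^ 3 = 8 ^ (s + 1)"
    by (simp add: power3_eq_cube flip: power_mult_distrib)
  finally show ?thesis
    using I by simp
qed

text \<open>Without memory the empty stream and a single empty clause look alike. This one bit
  absorbs the additive constant in the main estimate and settles the case
  \<open>d > N\<close>.\<close>

lemma dsat_needs_memory:
  assumes solves: "solves_dsat d N A" and stores: "stores_at_most d N A s"
  shows "s \<ge> 1"
proof (rule ccontr)
  assume "\<not> s \<ge> 1"
  then have s: "s = 0" by simp
  have inst: "dsat_instance d N []" "dsat_instance d N [{}]"
    by (auto simp: dsat_instance_def)
  \<comment> \<open>A one-bit code with one message would give 32 \<le> 27.\<close>
  have "(32::nat) ^ card {()} \<le> 27 ^ card {()} * card {[] :: memory} ^ 3"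
  proof (rule random_access_code_bound[where R = "shared A"
        and enc = "\<lambda>r X. run A r (if () \<in> X then [] else [{}])" and dec = "\<lambda>r m i. answer A r m"])
    show "set_pmf (run A r (if () \<in> X then [] else [{}])) \<subseteq> {[]}" if "r \<in> set_pmf (shared A)" for r X
    proof -
      have "dsat_instance d N (if () \<in> X then [] else [{}])"
        using inst by simp
      then have "\<forall>m \<in> set_pmf (run A r (if () \<in> X then [] else [{}])). length m \<le> s"
        using stores that unfolding stores_at_most_def by blast
      then show ?thesis
        using s by auto
    qed
    show "2 / 3 \<le> pmf (bind_pmf (shared A) (\<lambda>r. bind_pmf (run A r (if () \<in> X then [] else [{}]))
        (\<lambda>m. answer A r m))) (i \<in> X)" for X i
    proof -
      define cs :: "clause list" where "cs = (if () \<in> X then [] else [{}])"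
      have "dsat_instance d N cs" "satisfiable cs \<longleftrightarrow> i \<in> X"
        using inst by (auto simp: cs_def satisfiable_def)
      then have "2 / 3 \<le> pmf (outcome A cs) (i \<in> X)"
        using solves unfolding solves_dsat_def by auto
      then show ?thesis
        unfolding outcome_def cs_def .
    qed
  qed auto
  then show False by simp
qed

theorem theorem44:
  "\<exists>c::real. c > 0 \<and>
     (\<forall>d\<ge>2. \<forall>N. \<forall>A s. solves_dsat d N A \<longrightarrow> stores_at_most d N A s \<longrightarrow>
        real s \<ge> c * (real N / real d) ^ d)"
proof (intro exI[of _ "1 / 26"] conjI allI impI)
  fix d N s :: nat and A
  assume d: "2 \<le> d" and A: "solves_dsat d N A" "stores_at_most d N A s"
  have s: "s \<ge> 1"
    using dsat_needs_memory[OF A] .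
  show "1 / 26 * (real N / real d) ^ d \<le> real s"
  proof (cases "d \<le> N")
    case True
    define n where "n = N choose d"
    have "32 ^ n \<le> (27::nat) ^ n * 8 ^ (s + 1)"
      unfolding n_def using dsat_memory_bound[OF A] d by simp
    then have "real (32 ^ n) \<le> real (27 ^ n * 8 ^ (s + 1))"
      unfolding of_nat_le_iff .
    then have "(32 / 27 :: real) ^ n \<le> 8 ^ (s + 1)"
      by (simp add: power_divide divide_simps mult.commute)
    \<comment> \<open>13 is the least exponent for which the power of 32/27 reaches 8; then
      \<open>s \<ge> 1\<close> gives 13 (s + 1) \<le> 26 s, whence the constant 1/26.\<close>
    also have "\<dots> \<le> ((32 / 27) ^ 13) ^ (s + 1)"
      by (intro power_mono) (auto simp: power_divide)
    also have "\<dots> = (32 / 27) ^ (13 * (s + 1))"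
      by (rule power_mult[symmetric])
    finally have "n \<le> 13 * (s + 1)"
      by (subst (asm) power_increasing_iff) auto
    then have "real n \<le> 26 * real s"
      using s by simp
    then show ?thesis
      using binomial_ge_n_over_k_pow_k[OF True, where 'a = real] unfolding n_def by simp
  next
    \<comment> \<open>Here \<open>N choose d\<close> vanishes, but the claimed bound is below one
      bit.\<close>
    case False
    then have "(real N / real d) ^ d \<le> 1"
      by (intro power_le_one) auto
    then show ?thesis
      using s by simp
  qed
qed simp

end
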